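(* Let $L>N$ be natural numbers. For the Bernoulli–Laplace model with $L$ sites and $N$ particles the following hold: (i) for every admissible $\phi$ the convex Sobolev inequality holds with $\kappa_\phi=L$; (ii) the modified logarithmic Sobolev inequality holds with $\kappa_1=L+2$; (iii) for every $\alpha\in(1,2]$ the Beckner inequality holds with $\kappa_\alpha=\alpha L$.
   Context: Bernoulli–Laplace model: state space $\Omega=\{\eta:\{1,\dots,L\}\to\{0,1\}:\sum_{i=1}^L\eta_i=N\}$; moves $G=\{\sigma_{ij}:i,j\in\{1,\dots,L\}\}$ with $\sigma_{ij}\eta=\eta-\delta_i+\delta_j$ if $\eta_i(1-\eta_j)=1$ and $\sigma_{ij}\eta=\eta$ otherwise, where $(\delta_i)_k=1$ if $k=i$ and $0$ otherwise; rates $c(\eta,\sigma_{ij})=\eta_i(1-\eta_j)$; generator $\mathcal Lf(\eta)=\sum_{i,j}c(\eta,\sigma_{ij})(f(\sigma_{ij}\eta)-f(\eta))$; the reversible measure $\mathbf m$ is the uniform probability measure on $\Omega$. $\phi:[0,\infty)\to[0,\infty)$ is admissible if it is convex, twice differentiable on $(0,\infty)$, and $\Phi(a,b):=(\phi'(b)-\phi'(a))(b-a)$ is convex on $(0,\infty)^2$. $\mathcal H^\phi(f|\mathbf m)=\sum_\eta\phi(f(\eta))\mathbf m(\eta)-\phi\big(\sum_\eta f(\eta)\mathbf m(\eta)\big)$. The convex Sobolev inequality with constant $\kappa_\phi$ is: for all $f:\Omega\to(0,\infty)$, $$\kappa_\phi\,\mathcal H^\phi(f|\mathbf m)\le\frac12\sum_{\eta\in\Omega,\sigma\in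 G}c(\eta,\sigma)\,\Phi(f(\eta),f(\sigma\eta))\,\mathbf m(\eta).$$ Let $\phi_1(a)=a\log a-a+1$ and $\phi_\alpha(a)=\frac{1}{\alpha-1}(a^\alpha-a)-a+1$ for $\alpha\in(1,2]$. The modified logarithmic Sobolev inequality with constant $\kappa_1$ is the convex Sobolev inequality for $\phi=\phi_1$; the Beckner inequality with constant $\kappa_\alpha$ is the one for $\phi=\phi_\alpha$. *)

theory Defs
  imports "HOL-Probability.Probability_Mass_Function"
begin

definition bl_states :: "nat \<Rightarrow> nat \<Rightarrow> (nat \<Rightarrow> int) set" where
  "bl_states L N = {\<eta> \<in> {1..L} \<rightarrow>\<^sub>E {0, 1}. (\<Sum>i\<in>{1..L}. \<eta> i) = int N}"

definition bl_delta :: "nat \<Rightarrow> nat \<Rightarrow> int" where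
  "bl_delta i k = (if k = i then 1 else 0)"

definition bl_move :: "nat \<Rightarrow> nat \<Rightarrow> nat \<Rightarrow> (nat \<Rightarrow> int) \<Rightarrow> (nat \<Rightarrow> int)" where
  "bl_move L i j \<eta> =
     (if \<eta> i * (1 - \<eta> j) = 1
      then (\<lambda>k\<in>{1..L}. \<eta> k - bl_delta i k + bl_delta j k)
      else \<eta>)"

definition bl_rate :: "nat \<Rightarrow> nat \<Rightarrow> (nat \<Rightarrow> int) \<Rightarrow> real" where
  "bl_rate i j \<eta> = of_int (\<eta> i * (1 - \<eta> j))"

abbreviation bl_measure :: "nat \<Rightarrow> nat \<Rightarrow> (nat \<Rightarrow> int) \<Rightarrow> real" where
  "bl_measure L N \<equiv> pmf (pmf_of_set (bl_states L N))"

definition Phi :: "(real \<Rightarrow> real) \<Rightarrow> real \<Rightarrow> real \<Rightarrow> real" where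
  "Phi \<phi> a b = (deriv \<phi> b - deriv \<phi> a) * (b - a)"

text \<open>A function \<open>[0,\<infinity>) \<rightarrow> [0,\<infinity>)\<close> is a total function on the reals of which only the
  values on \<open>{0..}\<close> are constrained and used.\<close>

definition admissible :: "(real \<Rightarrow> real) \<Rightarrow> bool" where
  "admissible \<phi> \<longleftrightarrow>
     (\<forall>a\<ge>0. \<phi> a \<ge> 0) \<and>
     convex_on {0..} \<phi> \<and>
     \<phi> differentiable_on {0<..} \<and>
     deriv \<phi> differentiable_on {0<..} \<and>
     convex_on ({0<..} \<times> {0<..}) (\<lambda>(a, b). Phi \<phi> a b)"

definition bl_entropy :: "nat \<Rightarrow> nat \<Rightarrow> (real \<Rightarrow> real) \<Rightarrow> ((nat \<Rightarrow> int) \<Rightarrow> real) \<Rightarrow> real" where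
  "bl_entropy L N \<phi> f =
     (\<Sum>\<eta>\<in>bl_states L N. \<phi> (f \<eta>) * bl_measure L N \<eta>)
       - \<phi> (\<Sum>\<eta>\<in>bl_states L N. f \<eta> * bl_measure L N \<eta>)"

text \<open>The sum over the moves \<open>\<sigma>\<^sub>i\<^sub>j\<close> is written as a sum over pairs \<open>(i, j)\<close>. For \<open>0 < N < L\<close>
  distinct off-diagonal pairs give distinct maps on the state space, and the diagonal pairs,
  all giving the identity, have rate zero; for \<open>N = 0\<close> all rates vanish.\<close>

definition convex_sobolev :: "nat \<Rightarrow> nat \<Rightarrow> (real \<Rightarrow> real) \<Rightarrow> real \<Rightarrow> bool" where
  "convex_sobolev L N \<phi> \<kappa> \<longleftrightarrow>
     (\<forall>f. (\<forall>\<eta>\<in>bl_states L N. f \<eta> > 0) \<longrightarrow>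
        \<kappa> * bl_entropy L N \<phi> f \<le>
          1 / 2 * (\<Sum>\<eta>\<in>bl_states L N. \<Sum>i\<in>{1..L}. \<Sum>j\<in>{1..L}.
             bl_rate i j \<eta> * Phi \<phi> (f \<eta>) (f (bl_move L i j \<eta>)) * bl_measure L N \<eta>))"

definition phi_log :: "real \<Rightarrow> real" where
  "phi_log a = a * ln a - a + 1"

definition phi_beckner :: "real \<Rightarrow> real \<Rightarrow> real" where
  "phi_beckner \<alpha> a = 1 / (\<alpha> - 1) * (a powr \<alpha> - a) - a + 1"

definition modified_log_sobolev :: "nat \<Rightarrow> nat \<Rightarrow> real \<Rightarrow> bool" where
  "modified_log_sobolev L N \<kappa> \<longleftrightarrow> convex_sobolev L N phi_log \<kappa>"

definition beckner :: "nat \<Rightarrow> nat \<Rightarrow> real \<Rightarrow> real \<Rightarrow> bool" where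
  "beckner L N \<alpha> \<kappa> \<longleftrightarrow> convex_sobolev L N (phi_beckner \<alpha>) \<kappa>"

end

theory Submission
  imports Defs
begin

text \<open>For a positive \<open>f\<close> let \<open>H\<close> be its entropy and \<open>E\<close> the total energy, the sum of
  \<open>Phi \<phi> (f \<eta>) (f (\<sigma> \<eta>))\<close> over all moves, both unnormalised. Along the direction \<open>gen f\<close> the derivative of
  \<open>H\<close> is \<open>- E / 2\<close>, and coupling the dynamics started from two neighbouring configurations bounds the
  derivative of \<open>E\<close> by \<open>- \<kappa> E\<close>. No semigroup is needed to integrate this: for \<open>\<epsilon> > 0\<close> the functional
  \<open>G = E / 2 - (\<kappa> - \<epsilon>) H\<close> attains its minimum over the compact set of functions with values in
  \<open>[min f, max f]\<close>, which small steps in direction \<open>gen\<close> do not leave, and the derivative of \<open>G\<close> in that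
  direction is at most \<open>- \<epsilon> E / 2\<close>. So \<open>E = 0\<close> at the minimiser, whence \<open>H = 0\<close> there and \<open>G \<ge> 0\<close>.

  In the coupling, the \<open>L - 2\<close> coalescing jumps contribute \<open>- \<rho> Phi\<close> each, the swap of the two
  configurations contributes \<open>- 2 \<mu> Phi\<close>, and the remaining pairs of jumps conserve the energy, which gives
  \<open>\<kappa> = \<rho> (L - 2) + 2 \<mu>\<close>. Convexity of \<open>Phi\<close> alone gives \<open>\<rho> = \<mu> = 1\<close>; the logarithmic entropy
  has \<open>\<rho> = 1, \<mu> = 2\<close> and the power entropies have \<open>\<rho> = \<mu> = \<alpha>\<close>.\<close>

section \<open>Convex functions of a positive variable and the differential of the energy
  density\<close>

definition twice_diff_convex :: "(real \<Rightarrow> real) \<Rightarrow> bool" where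
  "twice_diff_convex \<phi> \<longleftrightarrow> convex_on {0<..} \<phi> \<and>
     (\<forall>x>0. \<phi> differentiable (at x) \<and> deriv \<phi> differentiable (at x))"

text \<open>The differential of \<open>Phi \<phi>\<close> at \<open>(a, b)\<close> in direction \<open>(u, v)\<close>.\<close>

definition dPhi :: "(real \<Rightarrow> real) \<Rightarrow> real \<Rightarrow> real \<Rightarrow> real \<Rightarrow> real \<Rightarrow> real" where
  "dPhi \<phi> a b u v = (deriv (deriv \<phi>) b * v - deriv (deriv \<phi>) a * u) * (b - a)
     + (deriv \<phi> b - deriv \<phi> a) * (v - u)"

lemma dPhi_add: "dPhi \<phi> a b (u + u') (v + v') = dPhi \<phi> a b u v + dPhi \<phi> a b u' v'"
  by (simp add: dPhi_def algebra_simps)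

text \<open>Linearity in the direction lets the generator, a sum over moves, be split into coupled
  pairs of jumps that are estimated one by one.\<close>

lemma dPhi_sum: "dPhi \<phi> a b (sum u S) (sum v S) = (\<Sum>s\<in>S. dPhi \<phi> a b (u s) (v s))"
proof (induction S rule: infinite_finite_induct)
  case (insert s S)
  then show ?case by (simp add: dPhi_add)
qed (simp_all add: dPhi_def)

lemma twice_diff_convexD:
  assumes "twice_diff_convex \<phi>" "x > 0"
  shows "(\<phi> has_real_derivative deriv \<phi> x) (at x)"
    and "(deriv \<phi> has_real_derivative deriv (deriv \<phi>) x) (at x)"
  using assms unfolding twice_diff_convex_def
  by (simp_all add: DERIV_deriv_iff_real_differentiable)

lemma twice_diff_convex_tangent:
  assumes "twice_diff_convex \<phi>" "x > 0" "y > 0"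
  shows "\<phi> x + deriv \<phi> x * (y - x) \<le> \<phi> y"
proof -
  have "\<phi> y - \<phi> x \<ge> deriv \<phi> x * (y - x)"
  proof (rule convex_on_imp_above_tangent[where A = "{0<..}"])
    show "(\<phi> has_real_derivative deriv \<phi> x) (at x within {0<..})"
      using twice_diff_convexD(1)[OF assms(1,2)] by (rule has_field_derivative_at_within)
  qed (use assms in \<open>auto simp: twice_diff_convex_def interior_open\<close>)
  then show ?thesis by simp
qed

text \<open>Add the tangent inequality at \<open>x\<close> evaluated at \<open>y\<close> to the one
  at \<open>y\<close> evaluated at \<open>x\<close>.\<close>

lemma Phi_nonneg:
  assumes "twice_diff_convex \<phi>" "x > 0" "y > 0"
  shows "Phi \<phi> x y \<ge> 0"
  using twice_diff_convex_tangent[OF assms] twice_diff_convex_tangent[OF assms(1,3,2)]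
  by (simp add: Phi_def algebra_simps)

lemma Phi_has_derivative_line:
  assumes "twice_diff_convex \<phi>" "a + t * u > 0" "b + t * v > 0"
  shows "((\<lambda>t. Phi \<phi> (a + t * u) (b + t * v)) has_real_derivative
           dPhi \<phi> (a + t * u) (b + t * v) u v) (at t)"
  unfolding Phi_def dPhi_def
  by (rule derivative_eq_intros DERIV_chain2[OF twice_diff_convexD(2)[OF assms(1)]] assms refl)+
     (simp add: algebra_simps)

section \<open>Entropy and energy on a finite reversible graph\<close>

text \<open>Moves are labels of unit rate, so several may share a target. Reversing labels encodes
  detailed balance for the counting measure; normalisation is postponed to the end.\<close>

locale reversible_moves =
  fixes V :: "'x set" and moves :: "'x \<Rightarrow> 'm set" and move :: "'x \<Rightarrow> 'm \<Rightarrow> 'x" and rev :: "'m \<Rightarrow> 'm"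
  assumes finite_V: "finite V" and V_nonempty: "V \<noteq> {}"
    and finite_moves: "x \<in> V \<Longrightarrow> finite (moves x)"
    and move_in_V: "x \<in> V \<Longrightarrow> m \<in> moves x \<Longrightarrow> move x m \<in> V"
    and rev_move: "x \<in> V \<Longrightarrow> m \<in> moves x \<Longrightarrow> rev m \<in> moves (move x m)"
    and move_rev: "x \<in> V \<Longrightarrow> m \<in> moves x \<Longrightarrow> move (move x m) (rev m) = x"
    and rev_rev: "rev (rev m) = m"
begin

definition gen :: "('x \<Rightarrow> real) \<Rightarrow> 'x \<Rightarrow> real" where
  "gen f x = (\<Sum>m\<in>moves x. f (move x m) - f x)"

definition avg :: "('x \<Rightarrow> real) \<Rightarrow> real" where
  "avg f = (\<Sum>x\<in>V. f x) / real (card V)"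

definition dirichlet :: "(real \<Rightarrow> real) \<Rightarrow> ('x \<Rightarrow> real) \<Rightarrow> real" where
  "dirichlet \<phi> f = (\<Sum>x\<in>V. \<Sum>m\<in>moves x. Phi \<phi> (f x) (f (move x m)))"

definition entropy :: "(real \<Rightarrow> real) \<Rightarrow> ('x \<Rightarrow> real) \<Rightarrow> real" where
  "entropy \<phi> f = (\<Sum>x\<in>V. \<phi> (f x)) - real (card V) * \<phi> (avg f)"

lemma card_V_pos: "real (card V) > 0"
  using finite_V V_nonempty by (simp add: card_gt_0_iff)

text \<open>Detailed balance: \<open>(x, m) \<mapsto> (move x m, rev m)\<close> is an involution on
  pairs that exchanges source and target.\<close>

lemma sum_reverse:
  "(\<Sum>x\<in>V. \<Sum>m\<in>moves x. g x (move x m)) = (\<Sum>x\<in>V. \<Sum>m\<in>moves x. (g (move x m) x :: real))"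
proof -
  let ?r = "\<lambda>(x, m). (move x m, rev m)"
  have "(\<Sum>(x, m)\<in>Sigma V moves. g x (move x m)) = (\<Sum>(x, m)\<in>Sigma V moves. g (move x m) x)"
    by (rule sum.reindex_bij_witness[of _ ?r ?r])
       (auto simp: move_in_V rev_move move_rev rev_rev)
  then show ?thesis
    by (simp add: sum.Sigma finite_V finite_moves)
qed

lemma sum_gen: "(\<Sum>x\<in>V. gen f x) = 0"
proof -
  have "(\<Sum>x\<in>V. gen f x) = (\<Sum>x\<in>V. \<Sum>m\<in>moves x. f x - f (move x m))"
    unfolding gen_def by (rule sum_reverse[of "\<lambda>x y. f y - f x"])
  also have "\<dots> = - (\<Sum>x\<in>V. gen f x)"
    unfolding gen_def by (simp add: sum_negf[symmetric])
  finally show ?thesis by simp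
qed

text \<open>Discrete integration by parts: averaging the sum with its reversal replaces
  \<open>deriv \<phi> (f x)\<close> by half a difference, which produces the shape of
  \<open>Phi\<close>.\<close>

lemma sum_deriv_gen: "(\<Sum>x\<in>V. deriv \<phi> (f x) * gen f x) = - dirichlet \<phi> f / 2"
proof -
  let ?S = "\<lambda>g. \<Sum>x\<in>V. \<Sum>m\<in>moves x. g x (move x m) :: real"
  have *: "(\<Sum>x\<in>V. deriv \<phi> (f x) * gen f x) = ?S (\<lambda>x y. deriv \<phi> (f x) * (f y - f x))"
    by (simp add: gen_def sum_distrib_left)
  have "2 * (\<Sum>x\<in>V. deriv \<phi> (f x) * gen f x)
      = ?S (\<lambda>x y. deriv \<phi> (f x) * (f y - f x)) + ?S (\<lambda>x y. deriv \<phi> (f y) * (f x - f y))"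
    using * sum_reverse[of "\<lambda>x y. deriv \<phi> (f x) * (f y - f x)"] by simp
  also have "\<dots> = - dirichlet \<phi> f"
    unfolding dirichlet_def Phi_def sum_negf[symmetric] sum.distrib[symmetric]
    by (intro sum.cong refl) (simp add: algebra_simps)
  finally show ?thesis by simp
qed

lemma dirichlet_nonneg:
  assumes "twice_diff_convex \<phi>" "\<forall>x\<in>V. f x > 0"
  shows "dirichlet \<phi> f \<ge> 0"
  unfolding dirichlet_def using assms(2)
  by (intro sum_nonneg Phi_nonneg[OF assms(1)]) (simp_all add: move_in_V)

lemma avg_pos:
  assumes "\<forall>x\<in>V. f x > 0"
  shows "avg f > 0"
  unfolding avg_def using assms finite_V V_nonempty card_V_pos by (intro divide_pos_pos sum_pos) auto

lemma sum_diff_avg: "(\<Sum>x\<in>V. f x - avg f) = 0"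
  using card_V_pos by (simp add: sum_subtractf avg_def)

text \<open>Jensen's inequality by the tangent at the mean, whose linear part sums to zero.\<close>

lemma entropy_nonneg:
  assumes "twice_diff_convex \<phi>" "\<forall>x\<in>V. f x > 0"
  shows "entropy \<phi> f \<ge> 0"
proof -
  have "(\<Sum>x\<in>V. \<phi> (f x)) \<ge> (\<Sum>x\<in>V. \<phi> (avg f) + deriv \<phi> (avg f) * (f x - avg f))"
    using assms(2) by (intro sum_mono twice_diff_convex_tangent[OF assms(1)] avg_pos) simp_all
  also have "(\<Sum>x\<in>V. \<phi> (avg f) + deriv \<phi> (avg f) * (f x - avg f)) = real (card V) * \<phi> (avg f)"
    by (simp add: sum.distrib sum_distrib_left[symmetric] sum_diff_avg)
  finally show ?thesis by (simp add: entropy_def)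
qed

text \<open>Since \<open>\<phi>\<close> may be affine on an interval, zero energy only forces
  \<open>deriv \<phi> (f x)\<close> to be constant, not \<open>f\<close>. The tangents at all
  \<open>f x\<close>, evaluated at the mean, then share one slope and their linear parts
  cancel.\<close>

lemma entropy_eq_0:
  assumes \<phi>: "twice_diff_convex \<phi>" and pos: "\<forall>x\<in>V. f x > 0"
    and const: "\<And>x. x \<in> V \<Longrightarrow> deriv \<phi> (f x) = d"
  shows "entropy \<phi> f = 0"
proof (rule antisym)
  have "(\<Sum>x\<in>V. \<phi> (f x)) \<le> (\<Sum>x\<in>V. \<phi> (avg f) + d * (f x - avg f))"
  proof (rule sum_mono)
    fix x assume "x \<in> V"
    then show "\<phi> (f x) \<le> \<phi> (avg f) + d * (f x - avg f)"
      using twice_diff_convex_tangent[OF \<phi> _ avg_pos[OF pos], of "f x"] pos const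
      by (simp add: algebra_simps)
  qed
  also have "\<dots> = real (card V) * \<phi> (avg f)"
    by (simp add: sum.distrib sum_distrib_left[symmetric] sum_diff_avg)
  finally show "entropy \<phi> f \<le> 0" by (simp add: entropy_def)
qed (rule entropy_nonneg[OF \<phi> pos])

lemma dirichlet_has_derivative_gen:
  assumes \<phi>: "twice_diff_convex \<phi>" and pos: "\<forall>x\<in>V. f x > 0"
  shows "((\<lambda>t. dirichlet \<phi> (\<lambda>x. f x + t * gen f x)) has_real_derivative
      (\<Sum>x\<in>V. \<Sum>m\<in>moves x. dPhi \<phi> (f x) (f (move x m)) (gen f x) (gen f (move x m)))) (at 0)"
  unfolding dirichlet_def
proof (intro DERIV_sum)
  fix x m assume "x \<in> V" "m \<in> moves x"
  with pos move_in_V show "((\<lambda>t. Phi \<phi> (f x + t * gen f x) (f (move x m) + t * gen f (move x m)))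
      has_real_derivative dPhi \<phi> (f x) (f (move x m)) (gen f x) (gen f (move x m))) (at 0)"
    using Phi_has_derivative_line[OF \<phi>, of "f x" 0 "gen f x" "f (move x m)" "gen f (move x m)"]
    by simp
qed

lemma entropy_has_derivative_gen:
  assumes \<phi>: "twice_diff_convex \<phi>" and pos: "\<forall>x\<in>V. f x > 0"
  shows "((\<lambda>t. entropy \<phi> (\<lambda>x. f x + t * gen f x)) has_real_derivative - dirichlet \<phi> f / 2) (at 0)"
proof -
  \<comment> \<open>The generator conserves mass, so the second term of the entropy is constant
    along the line.\<close>
  have avg: "avg (\<lambda>x. f x + t * gen f x) = avg f" for t
    by (simp add: avg_def sum.distrib sum_distrib_left[symmetric] sum_gen)
  have "((\<lambda>t. \<Sum>x\<in>V. \<phi> (f x + t * gen f x)) has_real_derivative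
      (\<Sum>x\<in>V. deriv \<phi> (f x) * gen f x)) (at 0)"
  proof (intro DERIV_sum)
    fix x assume "x \<in> V"
    then have "(\<phi> has_real_derivative deriv \<phi> (f x)) (at (f x + 0 * gen f x))"
      using twice_diff_convexD(1)[OF \<phi>] pos by simp
    then show "((\<lambda>t. \<phi> (f x + t * gen f x)) has_real_derivative deriv \<phi> (f x) * gen f x) (at 0)"
      by (rule DERIV_chain2) (auto intro!: derivative_eq_intros)
  qed
  then show ?thesis
    unfolding entropy_def avg sum_deriv_gen
    by (rule DERIV_diff[OF _ DERIV_const, THEN DERIV_cong]) simp
qed

end

section \<open>From the gradient estimate to the entropy inequality by minimisation\<close>

text \<open>Tychonoff's theorem: pinning the coordinates outside \<open>V\<close> to 0 makes the set
  a product of compact intervals and singletons.\<close>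

lemma compact_box_with_zeros:
  fixes a b :: real
  shows "compact {f :: 'x \<Rightarrow> real. (\<forall>x\<in>V. f x \<in> {a..b}) \<and> (\<forall>x. x \<notin> V \<longrightarrow> f x = 0)}"
proof -
  have "compactin (product_topology (\<lambda>i. euclidean) UNIV)
      (PiE (UNIV :: 'x set) (\<lambda>x. if x \<in> V then {a..b} else {0 :: real}))"
    unfolding compactin_PiE by auto
  also have "PiE (UNIV :: 'x set) (\<lambda>x. if x \<in> V then {a..b} else {0 :: real})
      = {f. (\<forall>x\<in>V. f x \<in> {a..b}) \<and> (\<forall>x. x \<notin> V \<longrightarrow> f x = 0)}"
    by (auto simp: PiE_UNIV_domain Pi_iff split: if_splits)
  finally show ?thesis
    unfolding euclidean_product_topology by simp
qed

context reversible_moves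
begin

text \<open>A discrete maximum principle: for such \<open>t\<close> the new value is a convex
  combination of \<open>f x\<close> and the values at the neighbours.\<close>

lemma box_step:
  assumes t: "0 \<le> t" "t * real (card (moves x)) \<le> 1" and x: "x \<in> V"
    and box: "\<And>x. x \<in> V \<Longrightarrow> f x \<in> {a..b}"
  shows "f x + t * gen f x \<in> {a..b}"
proof -
  let ?n = "real (card (moves x))"
  have "gen f x \<ge> (\<Sum>m\<in>moves x. a - f x)" "gen f x \<le> (\<Sum>m\<in>moves x. b - f x)"
    unfolding gen_def by (intro sum_mono; use box[OF move_in_V[OF x]] in force)+
  then have "t * gen f x \<ge> t * (?n * (a - f x))" "t * gen f x \<le> t * (?n * (b - f x))"
    using t by (auto intro!: mult_left_mono)
  moreover have "(1 - t * ?n) * (f x - a) \<ge> 0" "(1 - t * ?n) * (b - f x) \<ge> 0"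
    using t box[OF x] by auto
  ultimately show ?thesis by (simp add: algebra_simps)
qed

text \<open>Connectivity is expressed through functions invariant under all moves; it is applied to
  \<open>deriv \<phi>\<close> composed with the minimiser.\<close>

theorem entropy_le_dirichlet:
  assumes \<phi>: "twice_diff_convex \<phi>"
    and connected: "\<And>(g :: 'x \<Rightarrow> real) x y. (\<And>x m. x \<in> V \<Longrightarrow> m \<in> moves x \<Longrightarrow> g (move x m) = g x)
      \<Longrightarrow> x \<in> V \<Longrightarrow> y \<in> V \<Longrightarrow> g x = g y"
    and gradient: "\<And>f. \<forall>x\<in>V. f x > 0 \<Longrightarrow>
      (\<Sum>x\<in>V. \<Sum>m\<in>moves x. dPhi \<phi> (f x) (f (move x m)) (gen f x) (gen f (move x m)))
        \<le> - \<kappa> * dirichlet \<phi> f"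
    and pos: "\<forall>x\<in>V. f x > 0"
  shows "\<kappa> * entropy \<phi> f \<le> dirichlet \<phi> f / 2"
proof -
  have eps: "(\<kappa> - \<epsilon>) * entropy \<phi> f \<le> dirichlet \<phi> f / 2" if "\<epsilon> > 0" for \<epsilon>
  proof -
    define G where "G h = dirichlet \<phi> h / 2 - (\<kappa> - \<epsilon>) * entropy \<phi> h" for h
    define a where "a = Min (f ` V)"
    define b where "b = Max (f ` V)"
    define K where "K = {h :: 'x \<Rightarrow> real. (\<forall>x\<in>V. h x \<in> {a..b}) \<and> (\<forall>x. x \<notin> V \<longrightarrow> h x = 0)}"
    \<comment> \<open>Truncation outside \<open>V\<close> puts the function into \<open>K\<close>;
      \<open>G\<close> only sees values on \<open>V\<close>.\<close>
    define f0 where "f0 x = (if x \<in> V then f x else 0)" for x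
    have "a > 0" using pos finite_V V_nonempty by (simp add: a_def)
    have K_pos: "h x > 0" if "h \<in> K" "x \<in> V" for h x
      using that \<open>a > 0\<close> by (auto simp: K_def intro: less_le_trans)
    have f0: "f0 \<in> K" using finite_V by (auto simp: K_def f0_def a_def b_def)
    have coord: "continuous_on K (\<lambda>h. h x)" for x
      by (rule continuous_on_subset[OF continuous_on_product_coordinates]) auto
    have "continuous_on K G"
    proof -
      have c\<phi>: "continuous_on {0<..} \<phi>" and cd: "continuous_on {0<..} (deriv \<phi>)"
        using twice_diff_convexD[OF \<phi>]
        by (metis DERIV_isCont continuous_at_imp_continuous_on greaterThan_iff)+
      have "continuous_on K (\<lambda>h. \<phi> (h x))" "continuous_on K (\<lambda>h. deriv \<phi> (h x))" if "x \<in> V" for x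
        by (rule continuous_on_compose2[OF c\<phi> coord] continuous_on_compose2[OF cd coord];
            use that K_pos in force)+
      moreover have "continuous_on K (\<lambda>h. \<phi> (avg h))"
      proof (rule continuous_on_compose2[OF c\<phi>])
        show "continuous_on K avg"
          unfolding avg_def using card_V_pos by (intro continuous_intros coord) simp
        show "avg ` K \<subseteq> {0<..}" using avg_pos K_pos by blast
      qed
      ultimately show ?thesis
        unfolding G_def dirichlet_def entropy_def Phi_def
        by (intro continuous_intros coord) (simp_all add: move_in_V)
    qed
    moreover have "compact K" unfolding K_def by (rule compact_box_with_zeros)
    ultimately obtain h where h: "h \<in> K" and min: "\<And>k. k \<in> K \<Longrightarrow> G h \<le> G k"
      using continuous_attains_inf[of K G] f0 by blast
    have h_pos: "\<forall>x\<in>V. h x > 0" using K_pos h by blast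
    have "G h \<ge> 0"
    proof (cases "dirichlet \<phi> h = 0")
      case True
      have invariant: "deriv \<phi> (h (move x m)) = deriv \<phi> (h x)" if "x \<in> V" "m \<in> moves x" for x m
      proof -
        \<comment> \<open>A vanishing sum of nonnegative terms vanishes termwise, and
          \<open>Phi\<close> is zero only if the derivatives agree or the values do.\<close>
        have "\<And>x m. x \<in> V \<Longrightarrow> m \<in> moves x \<Longrightarrow> Phi \<phi> (h x) (h (move x m)) \<ge> 0"
          using h_pos by (intro Phi_nonneg[OF \<phi>]) (simp_all add: move_in_V)
        then have "Phi \<phi> (h x) (h (move x m)) = 0"
          using True that finite_V finite_moves unfolding dirichlet_def
          by (simp add: sum_nonneg_eq_0_iff sum_nonneg)
        then show ?thesis by (auto simp: Phi_def)
      qed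
      obtain y where "y \<in> V" using V_nonempty by blast
      have "entropy \<phi> h = 0"
      proof (rule entropy_eq_0[OF \<phi>])
        show "deriv \<phi> (h x) = deriv \<phi> (h y)" if "x \<in> V" for x
          by (rule connected[of "\<lambda>x. deriv \<phi> (h x)"]) (rule invariant that \<open>y \<in> V\<close>; assumption)+
      qed (rule h_pos)
      with True show ?thesis by (simp add: G_def)
    next
      case False
      \<comment> \<open>This case is contradictory: a small step along the generator stays in
        \<open>K\<close> and strictly lowers \<open>G\<close> below its minimum.\<close>
      then have D: "dirichlet \<phi> h > 0" using dirichlet_nonneg[OF \<phi> h_pos] by simp
      define h' where "h' t x = (if x \<in> V then h x + t * gen h x else 0)" for t x
      have G_eq: "G (h' t) = G (\<lambda>x. h x + t * gen h x)" for t
        unfolding G_def dirichlet_def entropy_def avg_def h'_def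
        by (simp add: move_in_V cong: sum.cong)
      let ?d = "(\<Sum>x\<in>V. \<Sum>m\<in>moves x. dPhi \<phi> (h x) (h (move x m)) (gen h x) (gen h (move x m))) / 2
          + (\<kappa> - \<epsilon>) * (dirichlet \<phi> h / 2)"
      have "((\<lambda>t. G (h' t)) has_real_derivative ?d) (at 0)"
        unfolding G_eq unfolding G_def
        by (rule DERIV_cong[OF DERIV_diff[OF DERIV_cdivide[OF dirichlet_has_derivative_gen[OF \<phi> h_pos]]
              DERIV_cmult[OF entropy_has_derivative_gen[OF \<phi> h_pos]]]]) simp
      moreover have "?d < 0"
        using gradient[OF h_pos] mult_pos_pos[OF \<open>\<epsilon> > 0\<close> D] by (simp add: field_simps)
      ultimately obtain s where s: "s > 0" "\<And>t. 0 < t \<Longrightarrow> t < s \<Longrightarrow> G (h' t) < G (h' 0)"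
        using DERIV_neg_dec_right[of "\<lambda>t. G (h' t)" ?d 0] by auto
      \<comment> \<open>A bound on all degrees at once; the extra 1 keeps \<open>1 / n\<close>
        meaningful when there are no moves.\<close>
      define n where "n = (\<Sum>x\<in>V. real (card (moves x))) + 1"
      have "n \<ge> 1" by (simp add: n_def sum_nonneg)
      \<comment> \<open>The bound \<open>s / 2\<close> keeps \<open>t\<close> strictly below
        \<open>s\<close>, and \<open>1 / n\<close> meets the condition of
        \<open>box_step\<close>.\<close>
      define t where "t = min (s / 2) (1 / n)"
      have t: "0 < t" "t < s" "t * n \<le> 1"
        using s(1) \<open>n \<ge> 1\<close> by (auto simp: t_def field_simps min_def)
      have "h' t \<in> K"
      proof -
        have "h x + t * gen h x \<in> {a..b}" if "x \<in> V" for x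
        proof (rule box_step)
          have "real (card (moves x)) \<le> (\<Sum>x\<in>V. real (card (moves x)))"
            using finite_V \<open>x \<in> V\<close> by (intro member_le_sum) auto
          then have "t * real (card (moves x)) \<le> t * n"
            using t(1) by (intro mult_left_mono) (auto simp: n_def)
          with t(3) show "t * real (card (moves x)) \<le> 1" by linarith
          show "h x \<in> {a..b}" if "x \<in> V" for x
            using h that by (auto simp: K_def)
        qed (use t that in auto)
        then show ?thesis by (auto simp: K_def h'_def)
      qed
      moreover have "h' 0 = h"
        using h by (auto simp: K_def h'_def)
      ultimately show ?thesis using min s(2)[OF t(1,2)] by fastforce
    qed
    also have "G h \<le> G f0" using min f0 by simp
    also have "G f0 = G f"
      unfolding G_def dirichlet_def entropy_def avg_def f0_def by (simp add: move_in_V cong: sum.cong)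
    finally show ?thesis by (simp add: G_def)
  qed
  show ?thesis
  proof (rule field_le_epsilon)
    fix e :: real assume "e > 0"
    \<comment> \<open>The added 1 avoids division by zero when the entropy vanishes.\<close>
    define \<epsilon> where "\<epsilon> = e / (entropy \<phi> f + 1)"
    have "entropy \<phi> f \<ge> 0" by (rule entropy_nonneg[OF \<phi> pos])
    with \<open>e > 0\<close> have "\<epsilon> > 0" "\<epsilon> * entropy \<phi> f \<le> e" by (auto simp: \<epsilon>_def field_simps)
    with eps[of \<epsilon>] show "\<kappa> * entropy \<phi> f \<le> dirichlet \<phi> f / 2 + e" by (simp add: algebra_simps)
  qed
qed

end

section \<open>Convexity of the energy density\<close>

text \<open>The first-order form of joint convexity of \<open>Phi\<close>, in which the coupling
  consumes it.\<close>

definition Phi_above_tangents :: "(real \<Rightarrow> real) \<Rightarrow> bool" where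
  "Phi_above_tangents \<phi> \<longleftrightarrow> (\<forall>a b a' b'. a > 0 \<longrightarrow> b > 0 \<longrightarrow> a' > 0 \<longrightarrow> b' > 0 \<longrightarrow>
     dPhi \<phi> a b (a' - a) (b' - b) \<le> Phi \<phi> a' b' - Phi \<phi> a b)"

text \<open>Restrict to the line through \<open>(a, b)\<close> and \<open>(a', b')\<close>: the
  tangent at parameter 0 lies below the convex function at parameter 1.\<close>

lemma Phi_above_tangentsI:
  assumes \<phi>: "twice_diff_convex \<phi>"
    and lines: "\<And>a b u v. a > 0 \<Longrightarrow> b > 0 \<Longrightarrow>
      convex_on {t. a + t * u > 0 \<and> b + t * v > 0} (\<lambda>t. Phi \<phi> (a + t * u) (b + t * v))"
  shows "Phi_above_tangents \<phi>"
  unfolding Phi_above_tangents_def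
proof (intro allI impI)
  fix a b a' b' :: real assume pos: "a > 0" "b > 0" "a' > 0" "b' > 0"
  define u v where "u = a' - a" and "v = b' - b"
  let ?T = "{t. a + t * u > 0 \<and> b + t * v > 0}"
  let ?h = "\<lambda>t. Phi \<phi> (a + t * u) (b + t * v)"
  have conv: "convex_on ?T ?h" using lines pos by blast
  have "open ?T" by (intro open_Collect_conj open_Collect_less continuous_intros)
  have "dPhi \<phi> a b u v * (1 - 0) \<le> ?h 1 - ?h 0"
  proof (rule convex_on_imp_above_tangent[OF conv])
    show "connected ?T" using conv by (simp add: convex_on_def convex_connected)
    show "0 \<in> interior ?T" using \<open>open ?T\<close> pos by (simp add: interior_open)
    show "1 \<in> ?T" using pos by (simp add: u_def v_def)
    show "(?h has_real_derivative dPhi \<phi> a b u v) (at 0 within ?T)"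
      using Phi_has_derivative_line[OF \<phi>, of a 0 u b v] pos
      by (auto intro: has_field_derivative_at_within)
  qed
  then show "dPhi \<phi> a b (a' - a) (b' - b) \<le> Phi \<phi> a' b' - Phi \<phi> a b"
    by (simp add: u_def v_def)
qed

lemma convex_positive_line: "convex {t. a + t * u > 0 \<and> b + t * v > (0 :: real)}"
proof (rule convexI)
  fix x y p q :: real
  assume x: "x \<in> {t. a + t * u > 0 \<and> b + t * v > 0}" and y: "y \<in> {t. a + t * u > 0 \<and> b + t * v > 0}"
    and pq: "p \<ge> 0" "q \<ge> 0" "p + q = 1"
  have pos: "p * X + q * Y > 0" if "X > 0" "Y > 0" for X Y
    using that pq by (cases "p = 0") (auto intro: add_pos_nonneg)
  have q: "q = 1 - p" using pq by simp
  have "a + (p * x + q * y) * u = p * (a + x * u) + q * (a + y * u)"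
    "b + (p * x + q * y) * v = p * (b + x * v) + q * (b + y * v)"
    unfolding q by (simp_all add: algebra_simps)
  then show "p *\<^sub>R x + q *\<^sub>R y \<in> {t. a + t * u > 0 \<and> b + t * v > 0}"
    using x y pos by simp
qed

lemma Phi_above_tangents_convex_on:
  assumes \<phi>: "twice_diff_convex \<phi>"
    and conv: "convex_on ({0<..} \<times> {0<..}) (\<lambda>(a, b). Phi \<phi> a b)"
  shows "Phi_above_tangents \<phi>"
proof (rule Phi_above_tangentsI[OF \<phi>])
  fix a b u v :: real
  let ?T = "{t. a + t * u > 0 \<and> b + t * v > 0}"
  show "convex_on ?T (\<lambda>t. Phi \<phi> (a + t * u) (b + t * v))"
  proof (rule convex_onI)
    fix t x y :: real assume t: "0 < t" "t < 1" and x: "x \<in> ?T" and y: "y \<in> ?T"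
    have *: "c + ((1 - t) * x + t * y) * w = (1 - t) * (c + x * w) + t * (c + y * w)" for c w :: real
      by (simp add: algebra_simps)
    show "Phi \<phi> (a + ((1 - t) *\<^sub>R x + t *\<^sub>R y) * u) (b + ((1 - t) *\<^sub>R x + t *\<^sub>R y) * v)
        \<le> (1 - t) * Phi \<phi> (a + x * u) (b + x * v) + t * Phi \<phi> (a + y * u) (b + y * v)"
      using convex_onD[OF conv, of t "(a + x * u, b + x * v)" "(a + y * u, b + y * v)"] t x y
      by (simp add: *)
  qed (rule convex_positive_line)
qed

text \<open>\<open>Phi\<close> vanishes on the diagonal, so the tangent inequality with target
  \<open>(c, c)\<close> retains only the negative term.\<close>

lemma dPhi_coalesce:
  assumes "Phi_above_tangents \<phi>" "a > 0" "b > 0" "c > 0"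
  shows "dPhi \<phi> a b (c - a) (c - b) \<le> - Phi \<phi> a b"
proof -
  have "dPhi \<phi> a b (c - a) (c - b) \<le> Phi \<phi> c c - Phi \<phi> a b"
    using assms unfolding Phi_above_tangents_def by blast
  then show ?thesis by (simp add: Phi_def)
qed

text \<open>A swap is the superposition of two coalescing jumps: to \<open>(b, b)\<close> and to \<open>(a, a)\<close>.\<close>

lemma dPhi_swap:
  assumes "\<And>c. c > 0 \<Longrightarrow> dPhi \<phi> a b (c - a) (c - b) \<le> - \<rho> * Phi \<phi> a b" "a > 0" "b > 0"
  shows "dPhi \<phi> a b (b - a) (a - b) \<le> - (2 * \<rho>) * Phi \<phi> a b"
  using assms(1)[OF assms(2)] assms(1)[OF assms(3)] dPhi_add[of \<phi> a b "b - a" 0 0 "a - b"]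
  by simp

section \<open>Power entropies: joint convexity and improved coalescence\<close>

text \<open>Weighted arithmetic-geometric mean with weights \<open>\<alpha> - 1\<close> and
  \<open>2 - \<alpha>\<close>, multiplied by \<open>b\<close>.\<close>

lemma powr_mix_le:
  fixes a b \<alpha> :: real
  assumes ab: "a > 0" "b > 0" and \<alpha>: "1 \<le> \<alpha>" "\<alpha> \<le> 2"
  shows "b powr (3 - \<alpha>) * a powr (\<alpha> - 1) \<le> (\<alpha> - 1) * (a * b) + (2 - \<alpha>) * b\<^sup>2"
proof -
  have "b powr (3 - \<alpha>) * a powr (\<alpha> - 1) = b * (a powr (\<alpha> - 1) * b powr (2 - \<alpha>))"
    using ab powr_add[of b 1 "2 - \<alpha>"] by simp
  also have "\<dots> \<le> b * ((\<alpha> - 1) * a + (2 - \<alpha>) * b)"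
    using ab \<alpha> by (intro mult_left_mono Youngs_inequality_0) auto
  finally show ?thesis by (simp add: algebra_simps power2_eq_square)
qed

text \<open>The determinant condition for the Hessian of \<open>Phi\<close> after removing the
  factor \<open>\<alpha>\<close>. The terms in \<open>p\<^sup>2\<close> and \<open>q\<^sup>2\<close>
  are traded for terms in \<open>p * q\<close> by \<open>powr_mix_le\<close>; what remains is
  \<open>p * q * ((\<alpha> - 1) * (2 - \<alpha>) * (a - b)\<^sup>2)\<close>.\<close>

lemma powr_hessian_det:
  fixes a b \<alpha> :: real
  assumes ab: "a > 0" "b > 0" and \<alpha>: "1 \<le> \<alpha>" "\<alpha> \<le> 2"
  defines "p \<equiv> a powr (\<alpha> - 3)" and "q \<equiv> b powr (\<alpha> - 3)"
  shows "(p * a + q * b)\<^sup>2 \<le> (p * (\<alpha> * a + (2 - \<alpha>) * b)) * (q * (\<alpha> * b + (2 - \<alpha>) * a))"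
proof -
  have pq: "p > 0" "q > 0" using ab by (auto simp: p_def q_def)
  have sq: "p * a\<^sup>2 = a powr (\<alpha> - 1)" "q * b\<^sup>2 = b powr (\<alpha> - 1)"
    and inv: "q * b powr (3 - \<alpha>) = 1" "p * a powr (3 - \<alpha>) = 1"
    using ab powr_add[of a "\<alpha> - 3" 2] powr_add[of b "\<alpha> - 3" 2]
      powr_add[of b "\<alpha> - 3" "3 - \<alpha>"] powr_add[of a "\<alpha> - 3" "3 - \<alpha>"]
    by (simp_all add: p_def q_def)
  have "p * a\<^sup>2 = q * (b powr (3 - \<alpha>) * a powr (\<alpha> - 1))"
    by (simp only: sq mult.assoc[symmetric] inv mult_1_left)
  also have "\<dots> \<le> q * ((\<alpha> - 1) * (a * b) + (2 - \<alpha>) * b\<^sup>2)"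
    using powr_mix_le[OF ab \<alpha>] pq by simp
  finally have 1: "p * a\<^sup>2 \<le> q * ((\<alpha> - 1) * (a * b) + (2 - \<alpha>) * b\<^sup>2)" .
  have "q * b\<^sup>2 = p * (a powr (3 - \<alpha>) * b powr (\<alpha> - 1))"
    by (simp only: sq mult.assoc[symmetric] inv mult_1_left)
  also have "\<dots> \<le> p * ((\<alpha> - 1) * (b * a) + (2 - \<alpha>) * a\<^sup>2)"
    using powr_mix_le[OF ab(2,1) \<alpha>] pq by simp
  finally have "q * b\<^sup>2 \<le> p * ((\<alpha> - 1) * (b * a) + (2 - \<alpha>) * a\<^sup>2)" .
  with 1 have "p * (p * a\<^sup>2) \<le> p * (q * ((\<alpha> - 1) * (a * b) + (2 - \<alpha>) * b\<^sup>2))"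
    "q * (q * b\<^sup>2) \<le> q * (p * ((\<alpha> - 1) * (b * a) + (2 - \<alpha>) * a\<^sup>2))"
    using pq by simp_all
  moreover have "0 \<le> p * q * ((\<alpha> - 1) * (2 - \<alpha>) * (a - b)\<^sup>2)"
    using pq \<alpha> by simp
  ultimately show ?thesis by (simp add: algebra_simps power2_eq_square)
qed

lemma quadratic_form_nonneg:
  fixes A B C u v :: real
  assumes "A > 0" "B\<^sup>2 \<le> A * C"
  shows "A * u\<^sup>2 + 2 * B * u * v + C * v\<^sup>2 \<ge> 0"
proof -
  have "0 \<le> (A * u + B * v)\<^sup>2 + (A * C - B\<^sup>2) * v\<^sup>2" using assms by simp
  also have "\<dots> = A * (A * u\<^sup>2 + 2 * B * u * v + C * v\<^sup>2)"
    by (simp add: algebra_simps power2_eq_square)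
  finally show ?thesis using assms(1) by (simp add: zero_le_mult_iff)
qed

text \<open>Covers both families: \<open>\<alpha> = 1\<close> is the logarithmic entropy and larger
  \<open>\<alpha>\<close> the Beckner entropies. The explicit \<open>\<psi>\<close> stands in for
  \<open>deriv \<phi>\<close>, with which it agrees at positive arguments.\<close>

locale power_entropy =
  fixes \<alpha> :: real and \<phi> \<psi> :: "real \<Rightarrow> real"
  assumes \<alpha>: "1 \<le> \<alpha>" "\<alpha> \<le> 2"
    and \<phi>_deriv: "x > 0 \<Longrightarrow> (\<phi> has_real_derivative \<psi> x) (at x)"
    and \<psi>_deriv: "x > 0 \<Longrightarrow> (\<psi> has_real_derivative \<alpha> * x powr (\<alpha> - 2)) (at x)"
begin

lemma deriv_\<phi>: "x > 0 \<Longrightarrow> deriv \<phi> x = \<psi> x"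
  by (rule DERIV_imp_deriv[OF \<phi>_deriv])

lemma deriv_has_derivative:
  assumes "x > 0"
  shows "(deriv \<phi> has_real_derivative \<alpha> * x powr (\<alpha> - 2)) (at x)"
  by (rule has_field_derivative_transform_within_open[OF \<psi>_deriv, of _ "{0<..}"])
     (use assms deriv_\<phi> in auto)

lemma deriv_deriv: "x > 0 \<Longrightarrow> deriv (deriv \<phi>) x = \<alpha> * x powr (\<alpha> - 2)"
  by (rule DERIV_imp_deriv[OF deriv_has_derivative])

lemma twice_diff_convex: "twice_diff_convex \<phi>"
  unfolding twice_diff_convex_def
proof (intro conjI allI impI)
  show "convex_on {0<..} \<phi>"
    by (rule f''_ge0_imp_convex[OF _ \<phi>_deriv \<psi>_deriv]) (use \<alpha> in auto)
qed (use \<phi>_deriv deriv_has_derivative in \<open>auto simp: real_differentiable_def\<close>)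

lemma Phi_above_tangents: "Phi_above_tangents \<phi>"
proof (rule Phi_above_tangentsI[OF twice_diff_convex])
  fix a b u v :: real
  let ?T = "{t. a + t * u > 0 \<and> b + t * v > 0}"
  let ?x = "\<lambda>t. a + t * u" and ?y = "\<lambda>t. b + t * v"
  let ?p = "\<lambda>t. ?x t powr (\<alpha> - 3)" and ?q = "\<lambda>t. ?y t powr (\<alpha> - 3)"
  let ?h' = "\<lambda>t. \<alpha> * (?y t powr (\<alpha> - 2) * v - ?x t powr (\<alpha> - 2) * u) * (?y t - ?x t)
      + (\<psi> (?y t) - \<psi> (?x t)) * (v - u)"
  let ?h'' = "\<lambda>t. \<alpha> * (?p t * (\<alpha> * ?x t + (2 - \<alpha>) * ?y t) * u\<^sup>2
      + 2 * (- (?p t * ?x t + ?q t * ?y t)) * u * v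
      + ?q t * (\<alpha> * ?y t + (2 - \<alpha>) * ?x t) * v\<^sup>2)"
  show "convex_on ?T (\<lambda>t. Phi \<phi> (?x t) (?y t))"
  proof (rule f''_ge0_imp_convex[where f' = ?h' and f'' = ?h''])
    fix t assume "t \<in> ?T"
    then have t: "?x t > 0" "?y t > 0" by auto
    show "((\<lambda>t. Phi \<phi> (?x t) (?y t)) has_real_derivative ?h' t) (at t)"
      using Phi_has_derivative_line[OF twice_diff_convex t]
      by (simp add: dPhi_def deriv_\<phi> deriv_deriv t algebra_simps)
    \<comment> \<open>Lowering the exponent to \<open>\<alpha> - 3\<close> turns the comparison with
      \<open>?h''\<close> into a polynomial identity in \<open>p\<close>, \<open>q\<close>,
      \<open>x\<close>, \<open>y\<close>.\<close>
    have split: "?x t powr (\<alpha> - 2) = ?p t * ?x t" "?y t powr (\<alpha> - 2) = ?q t * ?y t"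
      using t powr_add[of "?x t" "\<alpha> - 3" 1] powr_add[of "?y t" "\<alpha> - 3" 1] by simp_all
    have d: "((\<lambda>t. ?x t powr (\<alpha> - 2)) has_real_derivative (\<alpha> - 2) * ?p t * u) (at t)"
      "((\<lambda>t. ?y t powr (\<alpha> - 2)) has_real_derivative (\<alpha> - 2) * ?q t * v) (at t)"
      by (rule DERIV_chain2[OF has_real_derivative_powr, THEN DERIV_cong],
          use t in \<open>auto intro!: derivative_eq_intros\<close>)+
    have "((\<lambda>t. \<alpha> * (?y t powr (\<alpha> - 2) * v - ?x t powr (\<alpha> - 2) * u)) has_real_derivative
        \<alpha> * ((\<alpha> - 2) * ?q t * v * v - (\<alpha> - 2) * ?p t * u * u)) (at t)"
      by (intro DERIV_cmult DERIV_diff DERIV_cmult_right d)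
    moreover have line: "((\<lambda>t. c + t * w) has_real_derivative w) (at t)" for c w :: real
      by (auto intro!: derivative_eq_intros)
    have "((\<lambda>t. (\<psi> (?y t) - \<psi> (?x t)) * (v - u)) has_real_derivative
        (\<alpha> * ?y t powr (\<alpha> - 2) * v - \<alpha> * ?x t powr (\<alpha> - 2) * u) * (v - u)) (at t)"
      by (intro DERIV_cmult_right DERIV_diff DERIV_chain2[OF \<psi>_deriv] t line)
    ultimately have "(?h' has_real_derivative
        \<alpha> * ((\<alpha> - 2) * ?q t * v * v - (\<alpha> - 2) * ?p t * u * u) * (?y t - ?x t)
        + (v - u) * (\<alpha> * (?y t powr (\<alpha> - 2) * v - ?x t powr (\<alpha> - 2) * u))
        + (\<alpha> * ?y t powr (\<alpha> - 2) * v - \<alpha> * ?x t powr (\<alpha> - 2) * u) * (v - u)) (at t)"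
      by (intro DERIV_add DERIV_mult DERIV_diff line)
    moreover have "\<alpha> * ((\<alpha> - 2) * q * v * v - (\<alpha> - 2) * p * u * u) * (y - x)
        + (v - u) * (\<alpha> * (q * y * v - p * x * u)) + (\<alpha> * (q * y) * v - \<alpha> * (p * x) * u) * (v - u)
      = \<alpha> * (p * (\<alpha> * x + (2 - \<alpha>) * y) * u\<^sup>2 + 2 * (- (p * x + q * y)) * u * v
          + q * (\<alpha> * y + (2 - \<alpha>) * x) * v\<^sup>2)" for p q x y :: real
      by (simp add: algebra_simps power2_eq_square)
    ultimately show "(?h' has_real_derivative ?h'' t) (at t)"
      by (simp only: split)
    show "?h'' t \<ge> 0"
    proof (intro mult_nonneg_nonneg quadratic_form_nonneg)
      show "0 < ?p t * (\<alpha> * ?x t + (2 - \<alpha>) * ?y t)"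
      proof (rule mult_pos_pos[OF _ add_pos_nonneg])
        show "\<alpha> * ?x t > 0" "(2 - \<alpha>) * ?y t \<ge> 0" using t \<alpha> by simp_all
      qed (use t in simp)
      show "(- (?p t * ?x t + ?q t * ?y t))\<^sup>2
          \<le> ?p t * (\<alpha> * ?x t + (2 - \<alpha>) * ?y t) * (?q t * (\<alpha> * ?y t + (2 - \<alpha>) * ?x t))"
        using powr_hessian_det[OF t \<alpha>] by (simp only: power2_minus)
    qed (use \<alpha> in auto)
  qed (rule convex_positive_line)
qed

text \<open>The left side is affine in \<open>c\<close>. Its slope is nonpositive because the second
  derivative is decreasing in the weak sense, and its value at \<open>c = 0\<close> is the right
  side.\<close>

lemma dPhi_coalesce_power:
  assumes "a > 0" "b > 0" "c > 0"
  shows "dPhi \<phi> a b (c - a) (c - b)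
    \<le> - Phi \<phi> a b - \<alpha> * (b powr (\<alpha> - 1) - a powr (\<alpha> - 1)) * (b - a)"
proof -
  have split: "a powr (\<alpha> - 1) = a powr (\<alpha> - 2) * a" "b powr (\<alpha> - 1) = b powr (\<alpha> - 2) * b"
    using assms powr_add[of a "\<alpha> - 2" 1] powr_add[of b "\<alpha> - 2" 1] by simp_all
  have "(b powr (\<alpha> - 2) - a powr (\<alpha> - 2)) * (b - a) \<le> 0"
    using assms \<alpha> powr_mono2'[of "\<alpha> - 2" a b] powr_mono2'[of "\<alpha> - 2" b a]
    by (cases "a \<le> b") (auto simp: mult_le_0_iff)
  then have "\<alpha> * c * ((b powr (\<alpha> - 2) - a powr (\<alpha> - 2)) * (b - a)) \<le> 0"
    using assms \<alpha> by (simp add: mult_le_0_iff)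
  then show ?thesis
    using assms by (simp add: dPhi_def Phi_def deriv_deriv split algebra_simps)
qed

end

section \<open>The logarithmic and Beckner entropies\<close>

lemma power_entropy_log: "power_entropy 1 phi_log ln"
proof
  fix x :: real assume "x > 0"
  then show "(phi_log has_real_derivative ln x) (at x)"
    unfolding phi_log_def[abs_def] by (auto intro!: derivative_eq_intros)
  from \<open>x > 0\<close> show "(ln has_real_derivative 1 * x powr (1 - 2)) (at x)"
    by (auto intro!: derivative_eq_intros simp: powr_minus_divide)
qed auto

lemma power_entropy_beckner:
  assumes "1 < \<alpha>" "\<alpha> \<le> 2"
  shows "power_entropy \<alpha> (phi_beckner \<alpha>) (\<lambda>x. 1 / (\<alpha> - 1) * (\<alpha> * x powr (\<alpha> - 1) - 1) - 1)"
proof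
  fix x :: real assume x: "x > 0"
  show "(phi_beckner \<alpha> has_real_derivative 1 / (\<alpha> - 1) * (\<alpha> * x powr (\<alpha> - 1) - 1) - 1) (at x)"
    unfolding phi_beckner_def[abs_def]
    by (rule DERIV_cong[OF DERIV_add[OF DERIV_diff[OF DERIV_cmult[OF DERIV_diff[OF
          has_real_derivative_powr[OF x] DERIV_ident]] DERIV_ident] DERIV_const]]) simp
  show "((\<lambda>x. 1 / (\<alpha> - 1) * (\<alpha> * x powr (\<alpha> - 1) - 1) - 1) has_real_derivative
      \<alpha> * x powr (\<alpha> - 2)) (at x)"
    by (rule DERIV_cong[OF DERIV_diff[OF DERIV_cmult[OF DERIV_diff[OF DERIV_cmult[OF
          has_real_derivative_powr[OF x]] DERIV_const]] DERIV_const]]) (use assms in simp)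
qed (use assms in auto)

text \<open>Equality holds at 1, and the difference of the two sides has derivative
  \<open>(1 - 1 / y)\<^sup>2\<close>.\<close>

lemma ln_le_half_diff_inverse:
  fixes x :: real
  assumes "x \<ge> 1"
  shows "2 * ln x \<le> x - 1 / x"
proof -
  let ?g = "\<lambda>x :: real. x - 1 / x - 2 * ln x"
  have "?g 1 \<le> ?g x"
  proof (rule DERIV_nonneg_imp_nondecreasing[OF assms])
    fix y :: real assume "1 \<le> y" "y \<le> x"
    then have "(?g has_real_derivative (1 - 1 / y)\<^sup>2) (at y)"
      by (auto intro!: derivative_eq_intros simp: power2_eq_square field_simps)
    then show "\<exists>d. (?g has_real_derivative d) (at y) \<and> d \<ge> 0" by force
  qed
  then show ?thesis by simp
qed

text \<open>The gain over the general swap estimate comes from the trapezoidal bound for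
  the integral of the convex function \<open>1 / x\<close> over \<open>[a, b]\<close>.\<close>

lemma dPhi_swap_log:
  assumes "a > 0" "b > 0"
  shows "dPhi phi_log a b (b - a) (a - b) \<le> - 4 * Phi phi_log a b"
proof -
  interpret power_entropy 1 phi_log ln by (rule power_entropy_log)
  have *: "2 * (ln b - ln a) * (b - a) \<le> (1 / a + 1 / b) * (b - a)\<^sup>2"
    if ab: "a > 0" "a \<le> b" for a b :: real
  proof -
    have "2 * (ln b - ln a) \<le> b / a - 1 / (b / a)"
      using ln_le_half_diff_inverse[of "b / a"] ab by (simp add: ln_div)
    also have "\<dots> = (1 / a + 1 / b) * (b - a)"
      using ab by (simp add: field_simps)
    finally have "2 * (ln b - ln a) * (b - a) \<le> (1 / a + 1 / b) * (b - a) * (b - a)"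
      using ab by (intro mult_right_mono) auto
    then show ?thesis by (simp add: power2_eq_square mult.assoc)
  qed
  \<comment> \<open>Both sides are symmetric in \<open>a\<close> and \<open>b\<close>, so the
    ordered case suffices.\<close>
  have "2 * (ln b - ln a) * (b - a) \<le> (1 / a + 1 / b) * (b - a)\<^sup>2"
    using *[of a b] *[of b a] assms by (cases "a \<le> b") (auto simp: algebra_simps power2_eq_square)
  moreover have dd: "deriv (deriv phi_log) a = 1 / a" "deriv (deriv phi_log) b = 1 / b"
    using assms by (simp_all add: deriv_deriv powr_minus_divide)
  moreover have "(q * (a - b) - p * (b - a)) * (b - a) + l * (a - b - (b - a))
      = - ((p + q) * (b - a)\<^sup>2) - 2 * l * (b - a)" for p q l :: real
    by (simp add: algebra_simps power2_eq_square)
  \<comment> \<open>The second term is exactly \<open>- 2 * Phi phi_log a b\<close>, and the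
    trapezoidal bound makes the first at most that.\<close>
  then have "dPhi phi_log a b (b - a) (a - b)
      = - ((1 / a + 1 / b) * (b - a)\<^sup>2) - 2 * (ln b - ln a) * (b - a)"
    unfolding dPhi_def dd deriv_\<phi>[OF assms(1)] deriv_\<phi>[OF assms(2)] .
  moreover have "Phi phi_log a b = (ln b - ln a) * (b - a)"
    using assms by (simp add: Phi_def deriv_\<phi>)
  ultimately show ?thesis by linarith
qed

text \<open>For \<open>\<alpha> = 1\<close> the powers in the correction term are both 1, so it
  vanishes.\<close>

lemma dPhi_coalesce_log:
  assumes "a > 0" "b > 0" "c > 0"
  shows "dPhi phi_log a b (c - a) (c - b) \<le> - Phi phi_log a b"
  using power_entropy.dPhi_coalesce_power[OF power_entropy_log assms] assms by simp

text \<open>Here the correction term is exactly \<open>(\<alpha> - 1) * Phi\<close>, which raises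
  the constant from 1 to \<open>\<alpha>\<close>.\<close>

lemma dPhi_coalesce_beckner:
  assumes \<alpha>: "1 < \<alpha>" "\<alpha> \<le> 2" and pos: "a > 0" "b > 0" "c > 0"
  shows "dPhi (phi_beckner \<alpha>) a b (c - a) (c - b) \<le> - \<alpha> * Phi (phi_beckner \<alpha>) a b"
proof -
  interpret power_entropy \<alpha> "phi_beckner \<alpha>" "\<lambda>x. 1 / (\<alpha> - 1) * (\<alpha> * x powr (\<alpha> - 1) - 1) - 1"
    by (rule power_entropy_beckner[OF \<alpha>])
  have "deriv (phi_beckner \<alpha>) b - deriv (phi_beckner \<alpha>) a
      = \<alpha> * (b powr (\<alpha> - 1) - a powr (\<alpha> - 1)) / (\<alpha> - 1)"
    using pos by (simp add: deriv_\<phi> diff_divide_distrib right_diff_distrib)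
  then have "(\<alpha> - 1) * Phi (phi_beckner \<alpha>) a b = \<alpha> * (b powr (\<alpha> - 1) - a powr (\<alpha> - 1)) * (b - a)"
    using assms(1) by (simp add: Phi_def)
  then show ?thesis
    using dPhi_coalesce_power[OF pos] by (simp add: algebra_simps)
qed

section \<open>The Bernoulli--Laplace coupling\<close>

definition occupied :: "nat \<Rightarrow> (nat \<Rightarrow> int) \<Rightarrow> nat set" where
  "occupied L \<eta> = {i \<in> {1..L}. \<eta> i = 1}"

definition vacant :: "nat \<Rightarrow> (nat \<Rightarrow> int) \<Rightarrow> nat set" where
  "vacant L \<eta> = {i \<in> {1..L}. \<eta> i = 0}"

text \<open>Used for pairs in \<open>jumps L \<eta>\<close>, where it agrees with
  \<open>bl_move\<close> on the state space and the rate is 1.\<close>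

definition jump :: "(nat \<Rightarrow> int) \<Rightarrow> nat \<times> nat \<Rightarrow> (nat \<Rightarrow> int)" where
  "jump \<eta> = (\<lambda>(i, j). \<eta>(i := 0, j := 1))"

abbreviation jumps :: "nat \<Rightarrow> (nat \<Rightarrow> int) \<Rightarrow> (nat \<times> nat) set" where
  "jumps L \<eta> \<equiv> occupied L \<eta> \<times> vacant L \<eta>"

lemma finite_occupied [simp]: "finite (occupied L \<eta>)"
  and finite_vacant [simp]: "finite (vacant L \<eta>)"
  by (simp_all add: occupied_def vacant_def)

lemma occupied_jump:
  assumes "i \<in> occupied L \<eta>" "j \<in> vacant L \<eta>"
  shows "occupied L (jump \<eta> (i, j)) = insert j (occupied L \<eta> - {i})"
    and "vacant L (jump \<eta> (i, j)) = insert i (vacant L \<eta> - {j})"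
  using assms by (auto simp: occupied_def vacant_def jump_def)

lemma jump_back: "i \<in> occupied L \<eta> \<Longrightarrow> j \<in> vacant L \<eta> \<Longrightarrow> jump (jump \<eta> (i, j)) (j, i) = \<eta>"
  by (auto simp: occupied_def vacant_def jump_def)

lemma bl_states_values:
  assumes "\<eta> \<in> bl_states L N" "i \<in> {1..L}"
  shows "\<eta> i = 0 \<or> \<eta> i = 1"
proof -
  have "\<eta> \<in> {1..L} \<rightarrow>\<^sub>E {0, 1}" using assms(1) by (simp add: bl_states_def)
  from PiE_mem[OF this assms(2)] show ?thesis by simp
qed

lemma sum_eq_card_occupied:
  assumes "\<eta> \<in> {1..L} \<rightarrow>\<^sub>E {0, 1}"
  shows "(\<Sum>i\<in>{1..L}. \<eta> i) = int (card (occupied L \<eta>))"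
proof -
  have "(\<Sum>i\<in>{1..L}. \<eta> i) = (\<Sum>i\<in>{1..L}. if \<eta> i = 1 then 1 else 0)"
  proof (rule sum.cong[OF refl])
    fix i assume "i \<in> {1..L}"
    from PiE_mem[OF assms this] show "\<eta> i = (if \<eta> i = 1 then 1 else 0)" by auto
  qed
  also have "\<dots> = int (card ({1..L} \<inter> {i. \<eta> i = 1}))"
    by (simp add: sum.If_cases)
  also have "{1..L} \<inter> {i. \<eta> i = 1} = occupied L \<eta>"
    by (auto simp: occupied_def)
  finally show ?thesis .
qed

lemma bl_states_eq: "bl_states L N = {\<eta> \<in> {1..L} \<rightarrow>\<^sub>E {0, 1}. card (occupied L \<eta>) = N}"
  unfolding bl_states_def by (intro Collect_cong conj_cong refl) (simp only: sum_eq_card_occupied of_nat_eq_iff)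

lemma card_occupied: "\<eta> \<in> bl_states L N \<Longrightarrow> card (occupied L \<eta>) = N"
  by (simp add: bl_states_eq)

lemma card_vacant:
  assumes "\<eta> \<in> bl_states L N"
  shows "card (vacant L \<eta>) + N = L"
proof -
  have "vacant L \<eta> \<union> occupied L \<eta> = {1..L}"
    using bl_states_values[OF assms] unfolding vacant_def occupied_def by blast
  moreover have "vacant L \<eta> \<inter> occupied L \<eta> = {}"
    by (auto simp: vacant_def occupied_def)
  ultimately have "card (vacant L \<eta>) + card (occupied L \<eta>) = L"
    using card_Un_disjoint[OF finite_vacant finite_occupied, of L \<eta> L \<eta>] by simp
  then show ?thesis using card_occupied[OF assms] by simp
qed

lemma jump_in_bl_states:
  assumes "\<eta> \<in> bl_states L N" "i \<in> occupied L \<eta>" "j \<in> vacant L \<eta>"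
  shows "jump \<eta> (i, j) \<in> bl_states L N"
proof -
  have "j \<notin> occupied L \<eta>" using assms by (auto simp: occupied_def vacant_def)
  then have "card (occupied L (jump \<eta> (i, j))) = N"
    using assms card_Suc_Diff1[of "occupied L \<eta>" i] by (simp add: occupied_jump bl_states_eq)
  moreover have "jump \<eta> (i, j) \<in> {1..L} \<rightarrow>\<^sub>E {0, 1}"
    using assms by (auto simp: bl_states_eq jump_def PiE_iff extensional_def vacant_def occupied_def)
  ultimately show ?thesis by (simp add: bl_states_eq)
qed

lemma bl_move_eq_jump:
  assumes "\<eta> \<in> bl_states L N" "i \<in> occupied L \<eta>" "j \<in> vacant L \<eta>"
  shows "bl_move L i j \<eta> = jump \<eta> (i, j)"
  using assms
  by (auto simp: bl_move_def jump_def bl_delta_def occupied_def vacant_def bl_states_def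
      PiE_iff extensional_def fun_eq_iff restrict_def)

lemma finite_bl_states: "finite (bl_states L N)"
  unfolding bl_states_def by (rule finite_subset[OF _ finite_PiE[of "{1..L}" "\<lambda>_. {0, 1}"]]) auto

lemma bl_states_nonempty:
  assumes "N \<le> L"
  shows "bl_states L N \<noteq> {}"
proof -
  let ?\<eta> = "\<lambda>i\<in>{1..L}. if i \<le> N then 1 else 0 :: int"
  have "occupied L ?\<eta> = {1..N}" using assms by (auto simp: occupied_def)
  then have "?\<eta> \<in> bl_states L N" by (auto simp: bl_states_eq)
  then show ?thesis by blast
qed

text \<open>Moving a particle from a site occupied only in \<open>\<eta>\<close> to one occupied
  only in \<open>\<xi>\<close> removes one discrepancy, which gives an induction on their
  number.\<close>

lemma jump_invariant_const:
  assumes inv: "\<And>\<eta> m. \<eta> \<in> bl_states L N \<Longrightarrow> m \<in> jumps L \<eta> \<Longrightarrow> g (jump \<eta> m) = g \<eta>"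
    and "\<eta> \<in> bl_states L N" "\<xi> \<in> bl_states L N"
  shows "g \<eta> = g \<xi>"
  using assms(2)
proof (induction "card (occupied L \<eta> - occupied L \<xi>)" arbitrary: \<eta>)
  case 0
  then have "occupied L \<eta> \<subseteq> occupied L \<xi>" by simp
  then have eq: "occupied L \<eta> = occupied L \<xi>"
    using card_occupied[OF 0(2)] card_occupied[OF assms(3)] by (simp add: card_subset_eq)
  have "\<eta> = \<xi>"
  proof (rule PiE_ext)
    show "\<eta> \<in> {1..L} \<rightarrow>\<^sub>E {0, 1}" "\<xi> \<in> {1..L} \<rightarrow>\<^sub>E {0, 1}"
      using 0 assms(3) by (auto simp: bl_states_def)
    fix i assume i: "i \<in> {1..L}"
    with eq have "\<eta> i = 1 \<longleftrightarrow> \<xi> i = 1" by (auto simp: occupied_def)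
    then show "\<eta> i = \<xi> i"
      using bl_states_values[OF 0(2) i] bl_states_values[OF assms(3) i] by auto
  qed
  then show ?case by simp
next
  case (Suc n)
  have "occupied L \<eta> - occupied L \<xi> \<noteq> {}" using Suc(2) by (metis card.empty nat.simps(3))
  then obtain i where i: "i \<in> occupied L \<eta>" "i \<notin> occupied L \<xi>" by blast
  \<comment> \<open>Equal particle numbers make the two differences equinumerous, so a target site
    exists.\<close>
  have "card (occupied L \<xi> - occupied L \<eta>) = card (occupied L \<eta> - occupied L \<xi>)"
    using card_occupied[OF Suc(3)] card_occupied[OF assms(3)]
    by (simp add: card_Diff_subset_Int Int_commute)
  then have "occupied L \<xi> - occupied L \<eta> \<noteq> {}" using Suc(2) by (metis card.empty nat.simps(3))
  then obtain j where j: "j \<in> occupied L \<xi>" "j \<notin> occupied L \<eta>" by blast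
  then have "j \<in> vacant L \<eta>"
    using bl_states_values[OF Suc(3)] by (auto simp: occupied_def vacant_def)
  note ij = i(1) this
  have "occupied L (jump \<eta> (i, j)) - occupied L \<xi> = (occupied L \<eta> - occupied L \<xi>) - {i}"
    using occupied_jump(1)[OF ij] j by auto
  then have "n = card (occupied L (jump \<eta> (i, j)) - occupied L \<xi>)"
    using Suc(2) i by simp
  then have "g (jump \<eta> (i, j)) = g \<xi>"
    using Suc(1) jump_in_bl_states[OF Suc(3) ij] by blast
  then show ?case using inv[OF Suc(3)] ij by auto
qed

lemma reversible_moves_bl:
  assumes "N \<le> L"
  shows "reversible_moves (bl_states L N) (jumps L) jump prod.swap"
proof
  show "finite (bl_states L N)" by (rule finite_bl_states)
  show "bl_states L N \<noteq> {}" using assms by (rule bl_states_nonempty)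
qed (auto simp: jump_in_bl_states occupied_jump jump_back)

text \<open>The pairs of jumps of the coupling that do not coalesce leave \<open>i\<close> and \<open>j\<close> untouched; the
  involution \<open>(\<eta>, (i, j), (k, l)) \<mapsto> (jump \<eta> (k, l), (i, j), (l, k))\<close> shows that they conserve
  the total energy.\<close>

lemma sum_spectator_jumps:
  fixes F :: "(nat \<Rightarrow> int) \<Rightarrow> (nat \<Rightarrow> int) \<Rightarrow> real"
  shows "(\<Sum>\<eta>\<in>bl_states L N. \<Sum>(i, j)\<in>jumps L \<eta>.
      \<Sum>m\<in>(occupied L \<eta> - {i}) \<times> (vacant L \<eta> - {j}).
        F (jump \<eta> m) (jump (jump \<eta> (i, j)) m) - F \<eta> (jump \<eta> (i, j))) = 0"
proof -
  let ?S = "\<lambda>\<eta> (i, j). (occupied L \<eta> - {i}) \<times> (vacant L \<eta> - {j})"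
  let ?X = "SIGMA \<eta>:bl_states L N. SIGMA m:jumps L \<eta>. ?S \<eta> m"
  let ?G = "\<lambda>\<eta> m n. F (jump \<eta> n) (jump (jump \<eta> m) n) - F \<eta> (jump \<eta> m)"
  let ?r = "\<lambda>(\<eta>, m, n). (jump \<eta> n, m, prod.swap n) :: (nat \<Rightarrow> int) \<times> (nat \<times> nat) \<times> (nat \<times> nat)"
  have "(\<Sum>(\<eta>, m, n)\<in>?X. F \<eta> (jump \<eta> m)) = (\<Sum>(\<eta>, m, n)\<in>?X. F (jump \<eta> n) (jump (jump \<eta> m) n))"
  proof (rule sum.reindex_bij_witness[of _ ?r ?r], goal_cases)
    case (5 a)
    obtain \<eta> i j k l where "a = (\<eta>, (i, j), (k, l))" by (metis surj_pair)
    with 5 have a: "a = (\<eta>, (i, j), (k, l))" "i \<in> occupied L \<eta>" "j \<in> vacant L \<eta>"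
      "k \<in> occupied L \<eta>" "l \<in> vacant L \<eta>" "k \<noteq> i" "l \<noteq> j"
      by simp_all
    \<comment> \<open>The four sites are distinct, so the two jumps commute and undoing
      \<open>(k, l)\<close> leaves just \<open>(i, j)\<close>.\<close>
    then have "i \<noteq> l" "j \<noteq> k" by (auto simp: occupied_def vacant_def)
    with a have "jump (jump (jump \<eta> (k, l)) (i, j)) (l, k) = jump \<eta> (i, j)"
      by (auto simp: jump_def fun_eq_iff occupied_def vacant_def)
    with a show ?case by (simp add: jump_back)
  qed (auto simp: occupied_jump jump_back jump_in_bl_states, auto simp: occupied_def vacant_def)
  then have "(\<Sum>(\<eta>, m, n)\<in>?X. ?G \<eta> m n) = 0"
    by (simp add: sum_subtractf case_prod_unfold)
  also have "(\<Sum>(\<eta>, m, n)\<in>?X. ?G \<eta> m n)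
      = (\<Sum>\<eta>\<in>bl_states L N. \<Sum>(m, n)\<in>Sigma (jumps L \<eta>) (?S \<eta>). ?G \<eta> m n)"
    by (rule sum.Sigma[symmetric]) (auto simp: finite_bl_states intro!: finite_SigmaI)
  also have "\<dots> = (\<Sum>\<eta>\<in>bl_states L N. \<Sum>m\<in>jumps L \<eta>. \<Sum>n\<in>?S \<eta> m. ?G \<eta> m n)"
    by (intro sum.cong refl sum.Sigma[symmetric]) auto
  finally show ?thesis by (simp add: case_prod_unfold)
qed

text \<open>The corner will be the swap, the row and column the coalescing jumps, and the remaining
  rectangle the spectators.\<close>

lemma sum_jumps_split:
  fixes h :: "nat \<times> nat \<Rightarrow> real"
  assumes "finite C" "finite B" "i \<notin> C" "j \<notin> B"
  shows "(\<Sum>m\<in>insert i C \<times> insert j B. h m)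
    = h (i, j) + (\<Sum>l\<in>B. h (i, l)) + (\<Sum>k\<in>C. h (k, j)) + (\<Sum>m\<in>C \<times> B. h m)"
proof -
  have "(\<Sum>m\<in>insert i C \<times> insert j B. h m) = (\<Sum>k\<in>insert i C. \<Sum>l\<in>insert j B. h (k, l))"
    by (simp only: sum.cartesian_product case_prod_eta)
  also have "\<dots> = h (i, j) + (\<Sum>l\<in>B. h (i, l)) + (\<Sum>k\<in>C. h (k, j)) + (\<Sum>k\<in>C. \<Sum>l\<in>B. h (k, l))"
    using assms by (simp add: sum.distrib)
  finally show ?thesis by (simp only: sum.cartesian_product case_prod_eta)
qed

text \<open>The coupling of the dynamics started from \<open>\<eta>\<close> and from \<open>\<zeta> = jump \<eta> (i, j)\<close>: they coalesce
  when the particles at \<open>i\<close> and \<open>j\<close> jump to a common site or a common particle fills the holes at \<open>j\<close>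
  and \<open>i\<close> (total rate \<open>L - 2\<close>), they are swapped, or another particle makes the same jump in both.\<close>

lemma coupling_bound:
  assumes above: "Phi_above_tangents \<phi>"
    and coalesce: "\<And>a b c. a > 0 \<Longrightarrow> b > 0 \<Longrightarrow> c > 0 \<Longrightarrow>
      dPhi \<phi> a b (c - a) (c - b) \<le> - \<rho> * Phi \<phi> a b"
    and swap: "\<And>a b. a > 0 \<Longrightarrow> b > 0 \<Longrightarrow> dPhi \<phi> a b (b - a) (a - b) \<le> - (2 * \<mu>) * Phi \<phi> a b"
    and pos: "\<forall>\<eta>\<in>bl_states L N. f \<eta> > 0"
    and \<eta>: "\<eta> \<in> bl_states L N" and i: "i \<in> occupied L \<eta>" and j: "j \<in> vacant L \<eta>"
  defines "\<zeta> \<equiv> jump \<eta> (i, j)"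
  defines "spectators \<equiv> (occupied L \<eta> - {i}) \<times> (vacant L \<eta> - {j})"
  shows "dPhi \<phi> (f \<eta>) (f \<zeta>) (\<Sum>m\<in>jumps L \<eta>. f (jump \<eta> m) - f \<eta>) (\<Sum>m\<in>jumps L \<zeta>. f (jump \<zeta> m) - f \<zeta>)
    \<le> - (\<rho> * (real L - 2) + 2 * \<mu>) * Phi \<phi> (f \<eta>) (f \<zeta>)
      + (\<Sum>m\<in>spectators. Phi \<phi> (f (jump \<eta> m)) (f (jump \<zeta> m)) - Phi \<phi> (f \<eta>) (f \<zeta>))"
proof -
  define C where "C = occupied L \<eta> - {i}"
  define B where "B = vacant L \<eta> - {j}"
  have fin: "finite C" "finite B" by (simp_all add: C_def B_def)
  have CB: "i \<notin> C" "j \<notin> B" "i \<notin> B" "j \<notin> C" "i \<noteq> j"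
    using i j by (auto simp: C_def B_def occupied_def vacant_def)
  have jumps_\<eta>: "jumps L \<eta> = insert i C \<times> insert j B"
    using i j by (auto simp: C_def B_def)
  have jumps_\<zeta>: "jumps L \<zeta> = insert j C \<times> insert i B"
    using occupied_jump[OF i j] by (simp add: \<zeta>_def C_def B_def)
  have \<zeta>: "\<zeta> \<in> bl_states L N" unfolding \<zeta>_def by (rule jump_in_bl_states[OF \<eta> i j])
  have f_pos: "f \<eta> > 0" "f \<zeta> > 0" using \<eta> \<zeta> pos by auto
  have jump_pos: "f (jump \<eta> m) > 0" if "m \<in> jumps L \<eta>" for m
    using pos jump_in_bl_states[OF \<eta>] that by (cases m) auto
  have jump_pos': "f (jump \<zeta> m) > 0" if "m \<in> jumps L \<zeta>" for m
    using pos jump_in_bl_states[OF \<zeta>] that by (cases m) auto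
  \<comment> \<open>Coalescence: \<open>\<eta>\<close> and \<open>\<zeta>\<close> differ only in
    whether the particle sits at \<open>i\<close> or at \<open>j\<close>, so sending it to a common
    site makes them equal.\<close>
  have same: "jump \<zeta> (j, l) = jump \<eta> (i, l)" if "l \<in> B" for l
    using that CB j by (auto simp: \<zeta>_def B_def jump_def vacant_def fun_eq_iff)
  have same': "jump \<zeta> (k, i) = jump \<eta> (k, j)" if "k \<in> C" for k
    using that CB i by (auto simp: \<zeta>_def C_def jump_def occupied_def fun_eq_iff)
  let ?a = "f \<eta>" and ?b = "f \<zeta>"
  let ?D = "dPhi \<phi> ?a ?b" and ?P = "Phi \<phi> ?a ?b"
  have returns: "jump \<zeta> (j, i) = \<eta>" unfolding \<zeta>_def by (rule jump_back[OF i j])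
  \<comment> \<open>Splitting both jump sets alike pairs \<open>(i, j)\<close> with
    \<open>(j, i)\<close>, \<open>(i, l)\<close> with \<open>(j, l)\<close>, \<open>(k, j)\<close>
    with \<open>(k, i)\<close>, and each spectator with itself.\<close>
  have "?D (\<Sum>m\<in>jumps L \<eta>. f (jump \<eta> m) - ?a) (\<Sum>m\<in>jumps L \<zeta>. f (jump \<zeta> m) - ?b)
    = ?D (?b - ?a) (?a - ?b) + (\<Sum>l\<in>B. ?D (f (jump \<eta> (i, l)) - ?a) (f (jump \<zeta> (j, l)) - ?b))
      + (\<Sum>k\<in>C. ?D (f (jump \<eta> (k, j)) - ?a) (f (jump \<zeta> (k, i)) - ?b))
      + (\<Sum>m\<in>C \<times> B. ?D (f (jump \<eta> m) - ?a) (f (jump \<zeta> m) - ?b))"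
    unfolding jumps_\<eta> jumps_\<zeta> sum_jumps_split[OF fin CB(1,2)] sum_jumps_split[OF fin CB(4,3)]
      dPhi_add dPhi_sum returns \<zeta>_def[symmetric] ..
  also have "\<dots> \<le> - (2 * \<mu>) * ?P + (\<Sum>l\<in>B. - \<rho> * ?P) + (\<Sum>k\<in>C. - \<rho> * ?P)
      + (\<Sum>m\<in>C \<times> B. Phi \<phi> (f (jump \<eta> m)) (f (jump \<zeta> m)) - ?P)"
  proof (intro add_mono sum_mono)
    show "?D (?b - ?a) (?a - ?b) \<le> - (2 * \<mu>) * ?P" by (rule swap[OF f_pos])
    show "?D (f (jump \<eta> (i, l)) - ?a) (f (jump \<zeta> (j, l)) - ?b) \<le> - \<rho> * ?P" if "l \<in> B" for l
      using coalesce[OF f_pos jump_pos[of "(i, l)"]] that by (simp add: same jumps_\<eta>)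
    show "?D (f (jump \<eta> (k, j)) - ?a) (f (jump \<zeta> (k, i)) - ?b) \<le> - \<rho> * ?P" if "k \<in> C" for k
      using coalesce[OF f_pos jump_pos[of "(k, j)"]] that by (simp add: same' jumps_\<eta>)
    show "?D (f (jump \<eta> m) - ?a) (f (jump \<zeta> m) - ?b)
        \<le> Phi \<phi> (f (jump \<eta> m)) (f (jump \<zeta> m)) - ?P" if "m \<in> C \<times> B" for m
      using above f_pos jump_pos[of m] jump_pos'[of m] that unfolding Phi_above_tangents_def
      by (auto simp: jumps_\<eta> jumps_\<zeta>)
  qed
  \<comment> \<open>\<open>C\<close> lacks one of the \<open>N\<close> particles and
    \<open>B\<close> one of the \<open>L - N\<close> holes.\<close>
  also have "card B + card C + 2 = L"
    using card_Suc_Diff1[OF finite_occupied i] card_Suc_Diff1[OF finite_vacant j]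
      card_occupied[OF \<eta>] card_vacant[OF \<eta>] by (simp add: B_def C_def)
  then have "real L = real (card B) + real (card C) + 2" by linarith
  then have "- (2 * \<mu>) * ?P + (\<Sum>l\<in>B. - \<rho> * ?P) + (\<Sum>k\<in>C. - \<rho> * ?P)
      = - (\<rho> * (real L - 2) + 2 * \<mu>) * ?P"
    by (simp add: algebra_simps)
  finally show ?thesis by (simp add: spectators_def C_def B_def)
qed

section \<open>Assembling the inequalities\<close>

text \<open>On the state space the rate is the indicator of
  \<open>(i, j) \<in> jumps L \<eta>\<close>.\<close>

lemma sum_rate_eq:
  assumes "\<eta> \<in> bl_states L N"
  shows "(\<Sum>i\<in>{1..L}. \<Sum>j\<in>{1..L}. bl_rate i j \<eta> * h (f (bl_move L i j \<eta>)))
    = (\<Sum>m\<in>jumps L \<eta>. h (f (jump \<eta> m)))"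
proof -
  have "bl_rate i j \<eta> * h (f (bl_move L i j \<eta>))
      = (if (i, j) \<in> jumps L \<eta> then h (f (jump \<eta> (i, j))) else 0)"
    if "i \<in> {1..L}" "j \<in> {1..L}" for i j
  proof -
    show ?thesis
      using that bl_move_eq_jump[OF assms, of i j] bl_states_values[OF assms, of i]
        bl_states_values[OF assms, of j]
      by (auto simp: bl_rate_def occupied_def vacant_def)
  qed
  then have "(\<Sum>i\<in>{1..L}. \<Sum>j\<in>{1..L}. bl_rate i j \<eta> * h (f (bl_move L i j \<eta>)))
      = (\<Sum>i\<in>{1..L}. \<Sum>j\<in>{1..L}. if (i, j) \<in> jumps L \<eta> then h (f (jump \<eta> (i, j))) else 0)"
    by (intro sum.cong refl) blast
  also have "\<dots> = (\<Sum>m\<in>{1..L} \<times> {1..L}. if m \<in> jumps L \<eta> then h (f (jump \<eta> m)) else 0)"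
    by (subst sum.cartesian_product) (rule sum.cong, auto split: if_splits)
  also have "\<dots> = (\<Sum>m\<in>jumps L \<eta>. h (f (jump \<eta> m)))"
    by (rule sum.mono_neutral_cong_right) (auto simp: occupied_def vacant_def)
  finally show ?thesis .
qed

text \<open>Keeping \<open>\<rho>\<close> and \<open>\<mu>\<close> apart lets the logarithmic
  entropy use a swap bound stronger than the one its coalescence bound implies.\<close>

theorem convex_sobolev_of_coupling:
  assumes "N \<le> L" and \<phi>: "twice_diff_convex \<phi>" and above: "Phi_above_tangents \<phi>"
    and coalesce: "\<And>a b c. a > 0 \<Longrightarrow> b > 0 \<Longrightarrow> c > 0 \<Longrightarrow>
      dPhi \<phi> a b (c - a) (c - b) \<le> - \<rho> * Phi \<phi> a b"
    and swap: "\<And>a b. a > 0 \<Longrightarrow> b > 0 \<Longrightarrow> dPhi \<phi> a b (b - a) (a - b) \<le> - (2 * \<mu>) * Phi \<phi> a b"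
  shows "convex_sobolev L N \<phi> (\<rho> * (real L - 2) + 2 * \<mu>)"
  unfolding convex_sobolev_def
proof (intro allI impI)
  interpret reversible_moves "bl_states L N" "jumps L" jump prod.swap
    by (rule reversible_moves_bl[OF assms(1)])
  let ?\<kappa> = "\<rho> * (real L - 2) + 2 * \<mu>"
  let ?\<Omega> = "bl_states L N"
  have gradient: "(\<Sum>\<eta>\<in>?\<Omega>. \<Sum>m\<in>jumps L \<eta>. dPhi \<phi> (f \<eta>) (f (jump \<eta> m)) (gen f \<eta>) (gen f (jump \<eta> m)))
      \<le> - ?\<kappa> * dirichlet \<phi> f" if pos: "\<forall>\<eta>\<in>?\<Omega>. f \<eta> > 0" for f
  proof -
    let ?rest = "\<lambda>\<eta> (i, j). \<Sum>m\<in>(occupied L \<eta> - {i}) \<times> (vacant L \<eta> - {j}).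
      Phi \<phi> (f (jump \<eta> m)) (f (jump (jump \<eta> (i, j)) m)) - Phi \<phi> (f \<eta>) (f (jump \<eta> (i, j)))"
    have "(\<Sum>\<eta>\<in>?\<Omega>. \<Sum>m\<in>jumps L \<eta>. dPhi \<phi> (f \<eta>) (f (jump \<eta> m)) (gen f \<eta>) (gen f (jump \<eta> m)))
        \<le> (\<Sum>\<eta>\<in>?\<Omega>. \<Sum>m\<in>jumps L \<eta>. - ?\<kappa> * Phi \<phi> (f \<eta>) (f (jump \<eta> m)) + ?rest \<eta> m)"
    proof (intro sum_mono)
      fix \<eta> m assume "\<eta> \<in> ?\<Omega>" "m \<in> jumps L \<eta>"
      then show "dPhi \<phi> (f \<eta>) (f (jump \<eta> m)) (gen f \<eta>) (gen f (jump \<eta> m))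
          \<le> - ?\<kappa> * Phi \<phi> (f \<eta>) (f (jump \<eta> m)) + ?rest \<eta> m"
        using coupling_bound[OF above coalesce swap pos] by (cases m) (simp add: gen_def)
    qed
    also have "\<dots> = - ?\<kappa> * dirichlet \<phi> f + (\<Sum>\<eta>\<in>?\<Omega>. \<Sum>m\<in>jumps L \<eta>. ?rest \<eta> m)"
      by (simp only: dirichlet_def sum.distrib sum_distrib_left)
    also have "(\<Sum>\<eta>\<in>?\<Omega>. \<Sum>m\<in>jumps L \<eta>. ?rest \<eta> m) = 0"
      using sum_spectator_jumps[where F = "\<lambda>\<eta> \<zeta>. Phi \<phi> (f \<eta>) (f \<zeta>)"] by simp
    finally show ?thesis by simp
  qed
  fix f :: "(nat \<Rightarrow> int) \<Rightarrow> real" assume pos: "\<forall>\<eta>\<in>?\<Omega>. f \<eta> > 0"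
  let ?n = "real (card ?\<Omega>)"
  \<comment> \<open>The uniform weight is a common factor of both sides.\<close>
  have m: "bl_measure L N \<eta> = 1 / ?n" if "\<eta> \<in> ?\<Omega>" for \<eta>
    using that finite_V V_nonempty by (simp add: pmf_of_set)
  have "bl_entropy L N \<phi> f = entropy \<phi> f / ?n"
    using card_V_pos
    by (simp add: bl_entropy_def entropy_def avg_def m sum_divide_distrib[symmetric] diff_divide_distrib
        cong: sum.cong)
  moreover have "(\<Sum>\<eta>\<in>?\<Omega>. \<Sum>i\<in>{1..L}. \<Sum>j\<in>{1..L}.
      bl_rate i j \<eta> * Phi \<phi> (f \<eta>) (f (bl_move L i j \<eta>)) * bl_measure L N \<eta>) = dirichlet \<phi> f / ?n"
    unfolding dirichlet_def sum_divide_distrib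
  proof (rule sum.cong[OF refl])
    fix \<eta> assume \<eta>: "\<eta> \<in> ?\<Omega>"
    show "(\<Sum>i\<in>{1..L}. \<Sum>j\<in>{1..L}.
        bl_rate i j \<eta> * Phi \<phi> (f \<eta>) (f (bl_move L i j \<eta>)) * bl_measure L N \<eta>)
      = (\<Sum>m\<in>jumps L \<eta>. Phi \<phi> (f \<eta>) (f (jump \<eta> m)) / ?n)"
      using sum_rate_eq[OF \<eta>, of "Phi \<phi> (f \<eta>)" f] m[OF \<eta>]
      by (simp add: sum_divide_distrib[symmetric])
  qed
  moreover have "?\<kappa> * entropy \<phi> f \<le> dirichlet \<phi> f / 2"
    by (rule entropy_le_dirichlet[OF \<phi> jump_invariant_const gradient pos])
  then have "?\<kappa> * entropy \<phi> f / ?n \<le> dirichlet \<phi> f / 2 / ?n"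
    using card_V_pos by (intro divide_right_mono) auto
  ultimately show "?\<kappa> * bl_entropy L N \<phi> f \<le> 1 / 2 * (\<Sum>\<eta>\<in>?\<Omega>. \<Sum>i\<in>{1..L}. \<Sum>j\<in>{1..L}.
      bl_rate i j \<eta> * Phi \<phi> (f \<eta>) (f (bl_move L i j \<eta>)) * bl_measure L N \<eta>)"
    by simp
qed

lemma admissible_twice_diff_convex:
  assumes "admissible \<phi>"
  shows "twice_diff_convex \<phi>"
proof -
  have "convex_on {0..} \<phi>" using assms by (simp add: admissible_def)
  then have "convex_on {0<..} \<phi>" by (rule convex_on_subset) auto
  then show ?thesis
    using assms unfolding admissible_def twice_diff_convex_def
    by (auto simp: differentiable_on_eq_differentiable_at)
qed

theorem theorem5p1:
  fixes L N :: nat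
  assumes "L > N"
  shows "(\<forall>\<phi>. admissible \<phi> \<longrightarrow> convex_sobolev L N \<phi> (real L)) \<and>
         modified_log_sobolev L N (real L + 2) \<and>
         (\<forall>\<alpha>. 1 < \<alpha> \<and> \<alpha> \<le> 2 \<longrightarrow> beckner L N \<alpha> (\<alpha> * real L))"
proof (intro conjI allI impI)
  have NL: "N \<le> L" using assms by simp
  show "convex_sobolev L N \<phi> (real L)" if "admissible \<phi>" for \<phi>
  proof -
    have \<phi>: "twice_diff_convex \<phi>" using that by (rule admissible_twice_diff_convex)
    have above: "Phi_above_tangents \<phi>"
      using that by (intro Phi_above_tangents_convex_on[OF \<phi>]) (simp add: admissible_def)
    have coalesce: "dPhi \<phi> a b (c - a) (c - b) \<le> - 1 * Phi \<phi> a b"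
      if "a > 0" "b > 0" "c > 0" for a b c
      using dPhi_coalesce[OF above that] by simp
    have "convex_sobolev L N \<phi> (1 * (real L - 2) + 2 * 1)"
      by (rule convex_sobolev_of_coupling[OF NL \<phi> above coalesce dPhi_swap[OF coalesce]])
    then show ?thesis by simp
  qed
  show "modified_log_sobolev L N (real L + 2)"
  proof -
    interpret power_entropy 1 phi_log ln by (rule power_entropy_log)
    \<comment> \<open>The improved swap has \<open>\<mu> = 2\<close>, which accounts for the extra 2
      over the general constant.\<close>
    have "convex_sobolev L N phi_log (1 * (real L - 2) + 2 * 2)"
      by (rule convex_sobolev_of_coupling[OF NL twice_diff_convex Phi_above_tangents])
         (use dPhi_coalesce_log dPhi_swap_log in simp_all)
    then show ?thesis by (simp add: modified_log_sobolev_def add.commute)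
  qed
  show "beckner L N \<alpha> (\<alpha> * real L)" if \<alpha>_range: "1 < \<alpha> \<and> \<alpha> \<le> 2" for \<alpha>
  proof -
    interpret power_entropy \<alpha> "phi_beckner \<alpha>"
        "\<lambda>x. 1 / (\<alpha> - 1) * (\<alpha> * x powr (\<alpha> - 1) - 1) - 1"
      using \<alpha>_range by (intro power_entropy_beckner) auto
    note coalesce = dPhi_coalesce_beckner[OF conjunct1[OF \<alpha>_range] conjunct2[OF \<alpha>_range]]
    have "convex_sobolev L N (phi_beckner \<alpha>) (\<alpha> * (real L - 2) + 2 * \<alpha>)"
      by (rule convex_sobolev_of_coupling[OF NL twice_diff_convex Phi_above_tangents
            coalesce dPhi_swap[OF coalesce]])
    then show ?thesis by (simp add: beckner_def algebra_simps)
  qed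
qed

end
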